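(* Let $f,f_d,d,\delta,L,V_p$ and the anchored networks $G_\theta,H_\theta,W_\theta$, together with $E$, $\Phi_\theta$ and $q_p$, be as fixed in the context (in particular $f$ satisfies the homogeneous dominance assumption). Fix $\rho>0$, and let $\mathcal D\subset\mathbb R^n$ be compact with $\overline B_\rho\subset\operatorname{int}\mathcal D$. Suppose that $\overline B_\rho$ lies in the neighborhood of the origin where the expansion $f=f_d+r_f$, $\|r_f(x)\|\le L\|x\|^{d+\delta}$, holds, and that there exist $\eta>0$ and $M_q,M_d,L_G\ge0$ such that, for $\|u\|=1$ and $0<r\le\rho$, $$q_p(u)f_d(u)\le-\eta,\quad \|q_p(u)\|\le M_q,\quad \|f_d(u)\|\le M_d,\quad \|E(r,u)\|\le Lr^\delta,\quad \|DG_\theta(ru)\|\le L_G,$$ and $$\beta_\rho:=M_qL\rho^\delta+\rho L_G(M_d+L\rho^\delta)<\eta .$$ If, for some $c\in(0,1)$ and $\varepsilon>0$, $$x\in\mathcal D,\ \|x\|\ge\rho,\ W_\theta(x)\le c\ \Longrightarrow\ \Phi_\theta(x)\le-\varepsilon,$$ $$x\in\partial\mathcal D\ \Longrightarrow\ W_\theta(x)>c,$$ then $\Omega_{\theta,c}=\{x\in\mathcal D:W_\theta(x)\le c\}$ is compactly contained in $\operatorname{int}\mathcal D$, is positively invariant for $\dot x=f(x)$, and every trajectory of $\dot x=f(x)$ starting in it converges to the origin.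
   Context: Setting. $f\in C^1(\mathbb R^n;\mathbb R^n)$ with $f(0)=0$. $\|\cdot\|$ is the Euclidean norm for vectors and the induced operator norm for linear maps; $\overline B_\rho=\{x\in\mathbb R^n:\|x\|\le\rho\}$. A map $g$ is homogeneous of degree $s$ if $g(rx)=r^sg(x)$ for all $x\in\mathbb R^n$ and $r>0$. Homogeneous dominance assumption. There exist a real $d\ge1$, constants $\delta,L>0$, and a continuous $d$-homogeneous vector field $f_d$ such that the origin of $\dot x=f_d(x)$ is locally asymptotically stable and, in a neighborhood of the origin, $f(x)=f_d(x)+r_f(x)$ with $\|r_f(x)\|\le L\|x\|^{d+\delta}$. Local Lyapunov function. Fix $p>1$, $\mu>0$ and a positive definite, proper (compact sublevel sets), $p$-homogeneous function $V_p\in C^1(\mathbb R^n)\cap C^\infty(\mathbb R^n\setminus\{0\})$ with $DV_p(x)f_d(x)\le-\mu\|x\|^{p+d-1}$ for $x\ne0$ (such $V_p$ exists by Rosier's homogeneous converse Lyapunov theorem). Anchored networks. $N_\theta:\mathbb R^n\to\mathbb R$ is a fully connected feedforward network (at least one hidden layer, affine output layer) with componentwise tanh activations and parameter vector $\theta$; $G_\theta(x)=N_\theta(x)-N_\theta(0)$, $H_\theta(x)=V_p(x)e^{G_\theta(x)}$, $W_\theta(x)=\tanh H_\theta(x)$. Scaled quantities. For $x=ru\ne0$ with $r=\|x\|$ and $u=x/r$: $E(r,u)=r^{-d}f(ru)-f_d(u)$; $\Phi_\theta(x)=r^{1-d}\,D\log H_\theta(x)\,f(x)$; and $q_p(u)=D\log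 V_p(u)$ (a row vector) for $\|u\|=1$. *)

theory Defs
  imports "HOL-Analysis.Analysis"
begin

section \<open>Smoothness and homogeneity\<close>

text \<open>Only meant for open \<open>S\<close>. In finite dimension, differentiability at every point with
  continuity of all directional derivatives up to order \<open>k\<close> is the usual class $C^k$.\<close>

primrec C_k_on :: "nat \<Rightarrow> ('a::euclidean_space \<Rightarrow> 'b::real_normed_vector) \<Rightarrow> 'a set \<Rightarrow> bool" where
  "C_k_on 0 f S \<longleftrightarrow> continuous_on S f"
| "C_k_on (Suc k) f S \<longleftrightarrow>
     (\<forall>x\<in>S. f differentiable (at x)) \<and>
     (\<forall>v. C_k_on k (\<lambda>x. frechet_derivative f (at x) v) S)"

definition C_infinity_on :: "('a::euclidean_space \<Rightarrow> 'b::real_normed_vector) \<Rightarrow> 'a set \<Rightarrow> bool" where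
  "C_infinity_on f S \<longleftrightarrow> (\<forall>k. C_k_on k f S)"

definition homogeneous :: "real \<Rightarrow> ('a::real_vector \<Rightarrow> 'b::real_vector) \<Rightarrow> bool" where
  "homogeneous s g \<longleftrightarrow> (\<forall>x. \<forall>r>0. g (r *\<^sub>R x) = (r powr s) *\<^sub>R g x)"


section \<open>Autonomous differential equations\<close>

definition forward_solution ::
  "('a::real_normed_vector \<Rightarrow> 'a) \<Rightarrow> real set \<Rightarrow> (real \<Rightarrow> 'a) \<Rightarrow> bool" where
  "forward_solution f J x \<longleftrightarrow>
     is_interval J \<and> 0 \<in> J \<and> J \<subseteq> {0..} \<and>
     (\<forall>t\<in>J. (x has_vector_derivative f (x t)) (at t within J))"

text \<open>A trajectory is a forward solution that cannot be continued in forward time.\<close>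

definition trajectory ::
  "('a::real_normed_vector \<Rightarrow> 'a) \<Rightarrow> real set \<Rightarrow> (real \<Rightarrow> 'a) \<Rightarrow> bool" where
  "trajectory f J x \<longleftrightarrow>
     forward_solution f J x \<and>
     (\<forall>J' y. forward_solution f J' y \<and> J \<subseteq> J' \<and> (\<forall>t\<in>J. y t = x t) \<longrightarrow> J' = J)"

text \<open>Convergence is as time tends to infinity, hence includes existence for all forward time.\<close>

definition trajectories_from_converge_to_origin ::
  "('a::real_normed_vector \<Rightarrow> 'a) \<Rightarrow> 'a set \<Rightarrow> bool" where
  "trajectories_from_converge_to_origin f S \<longleftrightarrow>
     (\<forall>J x. trajectory f J x \<and> x 0 \<in> S \<longrightarrow> J = {0..} \<and> (x \<longlongrightarrow> 0) at_top)"

definition positively_invariant :: "('a::real_normed_vector \<Rightarrow> 'a) \<Rightarrow> 'a set \<Rightarrow> bool" where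
  "positively_invariant f S \<longleftrightarrow>
     (\<forall>J x. forward_solution f J x \<and> x 0 \<in> S \<longrightarrow> (\<forall>t\<in>J. x t \<in> S))"

text \<open>The field need not be locally Lipschitz, so all solutions from a given initial value
  are considered.\<close>

definition origin_locally_asymptotically_stable :: "('a::real_normed_vector \<Rightarrow> 'a) \<Rightarrow> bool" where
  "origin_locally_asymptotically_stable f \<longleftrightarrow>
     (\<forall>e>0. \<exists>a>0. \<forall>J x. forward_solution f J x \<and> norm (x 0) < a \<longrightarrow> (\<forall>t\<in>J. norm (x t) < e)) \<and>
     (\<exists>a>0. trajectories_from_converge_to_origin f (ball 0 a))"


section \<open>Homogeneous dominance and the local Lyapunov function\<close>

definition homogeneous_dominance ::
  "(real^'n \<Rightarrow> real^'n) \<Rightarrow> (real^'n \<Rightarrow> real^'n) \<Rightarrow> real \<Rightarrow> real \<Rightarrow> real \<Rightarrow> (real^'n) set \<Rightarrow> bool" where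
  "homogeneous_dominance f fd d \<delta> L U \<longleftrightarrow>
     d \<ge> 1 \<and> \<delta> > 0 \<and> L > 0 \<and>
     continuous_on UNIV fd \<and> homogeneous d fd \<and> origin_locally_asymptotically_stable fd \<and>
     open U \<and> 0 \<in> U \<and>
     (\<exists>rf. \<forall>x\<in>U. f x = fd x + rf x \<and> norm (rf x) \<le> L * norm x powr (d + \<delta>))"

definition local_lyapunov ::
  "(real^'n \<Rightarrow> real) \<Rightarrow> (real^'n \<Rightarrow> real^'n) \<Rightarrow> real \<Rightarrow> real \<Rightarrow> real \<Rightarrow> bool" where
  "local_lyapunov V fd p d \<mu> \<longleftrightarrow>
     V 0 = 0 \<and> (\<forall>x. x \<noteq> 0 \<longrightarrow> V x > 0) \<and>
     (\<forall>a. compact {x. V x \<le> a}) \<and>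
     homogeneous p V \<and>
     C_k_on 1 V UNIV \<and> C_infinity_on V (- {0}) \<and>
     (\<forall>x. x \<noteq> 0 \<longrightarrow>
       frechet_derivative V (at x) (fd x) \<le> - \<mu> * norm x powr (p + d - 1))"


section \<open>Anchored networks\<close>

text \<open>\<open>m\<close> lists the widths of the hidden layers. Parameter entries with indices beyond
  these widths are ignored. Layer \<open>0\<close> is the first hidden layer; its \<open>i\<close>-th weight row
  is \<open>in_weight \<theta> i\<close>.\<close>

record 'n net_params =
  in_weight :: "nat \<Rightarrow> real^'n"
  hid_weight :: "nat \<Rightarrow> nat \<Rightarrow> nat \<Rightarrow> real"
  hid_bias :: "nat \<Rightarrow> nat \<Rightarrow> real"
  out_weight :: "nat \<Rightarrow> real"
  out_bias :: real

definition valid_widths :: "nat list \<Rightarrow> bool" where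
  "valid_widths m \<longleftrightarrow> m \<noteq> [] \<and> (\<forall>k\<in>set m. k \<ge> 1)"

primrec activation :: "nat list \<Rightarrow> 'n net_params \<Rightarrow> nat \<Rightarrow> real^'n \<Rightarrow> nat \<Rightarrow> real" where
  "activation m \<theta> 0 x i = tanh (in_weight \<theta> i \<bullet> x + hid_bias \<theta> 0 i)"
| "activation m \<theta> (Suc l) x i =
     tanh ((\<Sum>j<m ! l. hid_weight \<theta> (Suc l) i j * activation m \<theta> l x j) + hid_bias \<theta> (Suc l) i)"

definition net :: "nat list \<Rightarrow> 'n net_params \<Rightarrow> real^'n \<Rightarrow> real" where
  "net m \<theta> x =
     (\<Sum>j<last m. out_weight \<theta> j * activation m \<theta> (length m - 1) x j) + out_bias \<theta>"

definition G_net :: "nat list \<Rightarrow> 'n net_params \<Rightarrow> real^'n \<Rightarrow> real" where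
  "G_net m \<theta> x = net m \<theta> x - net m \<theta> 0"

definition H_net :: "(real^'n \<Rightarrow> real) \<Rightarrow> nat list \<Rightarrow> 'n net_params \<Rightarrow> real^'n \<Rightarrow> real" where
  "H_net V m \<theta> x = V x * exp (G_net m \<theta> x)"

definition W_net :: "(real^'n \<Rightarrow> real) \<Rightarrow> nat list \<Rightarrow> 'n net_params \<Rightarrow> real^'n \<Rightarrow> real" where
  "W_net V m \<theta> x = tanh (H_net V m \<theta> x)"


section \<open>Scaled quantities\<close>

definition E_scaled ::
  "(real^'n \<Rightarrow> real^'n) \<Rightarrow> (real^'n \<Rightarrow> real^'n) \<Rightarrow> real \<Rightarrow> real \<Rightarrow> real^'n \<Rightarrow> real^'n" where
  "E_scaled f fd d r u = (r powr (- d)) *\<^sub>R f (r *\<^sub>R u) - fd u"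

definition \<Phi>_scaled ::
  "(real^'n \<Rightarrow> real^'n) \<Rightarrow> (real^'n \<Rightarrow> real) \<Rightarrow> real \<Rightarrow> nat list \<Rightarrow> 'n net_params \<Rightarrow> real^'n \<Rightarrow> real" where
  "\<Phi>_scaled f V d m \<theta> x =
     norm x powr (1 - d) * frechet_derivative (\<lambda>y. ln (H_net V m \<theta> y)) (at x) (f x)"

text \<open>Row vectors are linear functionals, measured by \<open>onorm\<close>.\<close>

definition q_row :: "(real^'n \<Rightarrow> real) \<Rightarrow> real^'n \<Rightarrow> real^'n \<Rightarrow> real" where
  "q_row V u = frechet_derivative (\<lambda>y. ln (V y)) (at u)"


section \<open>Sublevel sets\<close>

definition compactly_contained :: "'a::topological_space set \<Rightarrow> 'a set \<Rightarrow> bool" where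
  "compactly_contained A B \<longleftrightarrow> compact (closure A) \<and> closure A \<subseteq> B"

definition \<Omega>_net ::
  "(real^'n) set \<Rightarrow> (real^'n \<Rightarrow> real) \<Rightarrow> nat list \<Rightarrow> 'n net_params \<Rightarrow> real \<Rightarrow> (real^'n) set" where
  "\<Omega>_net D V m \<theta> c = {x \<in> D. W_net V m \<theta> x \<le> c}"

end

theory Submission
  imports Defs
begin

text \<open>Dividing the orbital derivative of \<open>ln H\<close> by \<open>\<parallel>x\<parallel> powr (d - 1)\<close> makes it comparable at all
  scales. Inside the ball of radius \<open>\<rho>\<close>, homogeneity of \<open>V\<close> reduces it to the value of \<open>q_p f_d\<close> on
  the unit sphere plus errors of size at most \<open>\<beta>\<^sub>\<rho> < \<eta>\<close>; outside the ball it is at most \<open>- \<epsilon>\<close> by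
  assumption. So on the sublevel set minus the origin \<open>H\<close> decreases along solutions, at a rate bounded
  away from zero off every neighbourhood of the origin. Strict decrease on the level \<open>W = c\<close>, which
  does not meet the boundary of \<open>D\<close>, gives invariance. A maximal solution in a compact set is defined
  for all times (Picard), and then \<open>H\<close> must tend to zero along it.\<close>


section \<open>Continuously differentiable vector fields\<close>

lemma C1_has_derivative:
  assumes "C_k_on 1 f S" "x \<in> S"
  shows "(f has_derivative frechet_derivative f (at x)) (at x)"
  using assms by (simp add: frechet_derivative_works)

text \<open>\<open>C_k_on 1\<close> only provides continuity of the directional derivative for each
  fixed direction. Bounds for the finitely many basis directions, combined by linearity, give one
  that is uniform in \<open>v\<close>.\<close>

lemma C1_bounded_derivative:
  fixes f :: "'a::euclidean_space \<Rightarrow> 'b::real_normed_vector"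
  assumes f: "C_k_on 1 f UNIV" and K: "compact K"
  obtains B where "\<And>x v. x \<in> K \<Longrightarrow> norm (frechet_derivative f (at x) v) \<le> norm v * B"
proof -
  have "\<exists>C. \<forall>x\<in>K. norm (frechet_derivative f (at x) b) \<le> C" for b
  proof -
    have "continuous_on K (\<lambda>x. frechet_derivative f (at x) b)"
      using f by (auto intro: continuous_on_subset)
    then have "bounded ((\<lambda>x. frechet_derivative f (at x) b) ` K)"
      using K compact_continuous_image compact_imp_bounded by blast
    then show ?thesis
      by (auto simp: bounded_iff)
  qed
  then obtain C where C: "\<And>x b. x \<in> K \<Longrightarrow> norm (frechet_derivative f (at x) b) \<le> C b"
    by metis
  have "norm (frechet_derivative f (at x) v) \<le> norm v * (\<Sum>b\<in>Basis. C b)" if x: "x \<in> K" for x v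
  proof -
    have lin: "linear (frechet_derivative f (at x))"
      using C1_has_derivative[OF f] has_derivative_linear by blast
    have "frechet_derivative f (at x) v = frechet_derivative f (at x) (\<Sum>b\<in>Basis. (v \<bullet> b) *\<^sub>R b)"
      by (simp add: euclidean_representation)
    also have "\<dots> = (\<Sum>b\<in>Basis. (v \<bullet> b) *\<^sub>R frechet_derivative f (at x) b)"
      by (simp add: linear_sum[OF lin] linear_cmul[OF lin])
    also have "norm \<dots> \<le> (\<Sum>b\<in>Basis. norm v * C b)"
      by (rule sum_norm_le) (auto intro!: mult_mono C x simp: Basis_le_norm)
    finally show ?thesis
      by (simp add: sum_distrib_left)
  qed
  then show ?thesis
    using that by blast
qed

lemma C1_lipschitz_on:
  fixes f :: "'a::euclidean_space \<Rightarrow> 'b::real_normed_vector"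
  assumes f: "C_k_on 1 f UNIV" and K: "compact K" "convex K"
  obtains B where "B-lipschitz_on K f"
proof -
  obtain B where B: "\<And>x v. x \<in> K \<Longrightarrow> norm (frechet_derivative f (at x) v) \<le> norm v * B"
    using C1_bounded_derivative[OF f K(1)] by blast
  \<comment> \<open>\<open>B\<close> comes without a sign (\<open>K\<close> may be empty), while a
    Lipschitz constant has to be nonnegative.\<close>
  have "(max 0 B)-lipschitz_on K f"
  proof (rule bounded_derivative_imp_lipschitz[OF _ K(2)])
    show "(f has_derivative frechet_derivative f (at x)) (at x within K)" if "x \<in> K" for x
      using C1_has_derivative[OF f] has_derivative_at_withinI by blast
    show "onorm (frechet_derivative f (at x)) \<le> max 0 B" if "x \<in> K" for x
    proof (rule onorm_bound)
      fix v show "norm (frechet_derivative f (at x) v) \<le> max 0 B * norm v"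
        using B[OF that, of v] mult_right_mono[of B "max 0 B" "norm v"] by (simp add: mult.commute)
    qed simp
  qed simp
  then show ?thesis
    using that by blast
qed

lemma C1_continuous_on:
  assumes "C_k_on 1 f UNIV"
  shows "continuous_on S f"
  using C1_has_derivative[OF assms] by (meson UNIV_I has_derivative_continuous_on has_derivative_at_withinI)

text \<open>Mean value inequality for curves. It keeps local solutions inside a ball and makes
  solutions with bounded velocity Lipschitz in time.\<close>

lemma has_vector_derivative_bound:
  fixes x :: "real \<Rightarrow> 'a::real_normed_vector"
  assumes "convex S" "\<And>t. t \<in> S \<Longrightarrow> (x has_vector_derivative x' t) (at t within S)"
    "\<And>t. t \<in> S \<Longrightarrow> norm (x' t) \<le> B" "s \<in> S" "t \<in> S"
  shows "norm (x s - x t) \<le> B * norm (s - t)"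
proof (rule differentiable_bound[where f' = "\<lambda>t h. h *\<^sub>R x' t"])
  show "onorm (\<lambda>h. h *\<^sub>R x' t) \<le> B" if "t \<in> S" for t
    using assms(3)[OF that] by (intro onorm_le) (auto simp: mult.commute[of B] intro: mult_left_mono)
qed (use assms in \<open>auto simp: has_vector_derivative_def\<close>)


section \<open>Existence and continuation of solutions\<close>

text \<open>The integral operator \<open>P\<close> is a contraction with constant
  \<open>K * \<tau>\<close> on the Banach space of bounded continuous curves; its fixed point solves
  the integral equation.\<close>

lemma picard_lipschitz:
  fixes f :: "'a::banach \<Rightarrow> 'a"
  assumes f: "K-lipschitz_on UNIV f" and \<tau>: "0 < \<tau>" "K * \<tau> < 1"
  obtains y where "y 0 = x0"
    "\<And>t. t \<in> {0..\<tau>} \<Longrightarrow> (y has_vector_derivative f (y t)) (at t within {0..\<tau>})"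
proof -
  \<comment> \<open>Bounded continuous functions live on the whole real line, so time is clamped to
    \<open>{0..\<tau>}\<close>: every \<open>P y\<close> is constant outside that interval.\<close>
  define c where "c t = min \<tau> (max 0 t)" for t :: real
  define P where "P y t = x0 + integral {0..c t} (\<lambda>s. f (y s))" for y :: "real \<Rightarrow>\<^sub>C 'a" and t
  have c: "c t \<in> {0..\<tau>}" for t
    using \<tau> by (auto simp: c_def)
  have contf: "continuous_on S f" for S
    using lipschitz_on_continuous_on[OF f] continuous_on_subset by blast
  have cont: "continuous_on S (\<lambda>s. f (apply_bcontfun y s))" for y S
    by (rule continuous_on_compose2[OF contf[of UNIV]]) (auto intro: continuous_on_apply_bcontfun)
  have int: "(\<lambda>s. f (apply_bcontfun y s)) integrable_on {a..b}" for y and a b :: real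
    by (rule integrable_continuous_real[OF cont])
  have "P y \<in> bcontfun" for y
  proof -
    \<comment> \<open>\<open>P y\<close> factors through \<open>g\<close> on the compact interval
      \<open>{0..\<tau>}\<close>, hence is bounded even if \<open>f\<close> is not.\<close>
    define g where "g t = x0 + integral {0..t} (\<lambda>s. f (apply_bcontfun y s))" for t
    have g: "continuous_on {0..\<tau>} g"
      unfolding g_def by (intro continuous_intros indefinite_integral_continuous_1 int)
    have Pg: "P y = (\<lambda>t. g (c t))"
      by (simp add: P_def g_def fun_eq_iff)
    have "continuous_on UNIV c"
      unfolding c_def by (intro continuous_intros)
    then have "continuous_on UNIV (P y)"
      unfolding Pg using c by (intro continuous_on_compose2[OF g]) auto
    moreover have "bounded (g ` {0..\<tau>})"
      using g by (simp add: compact_continuous_image compact_imp_bounded)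
    then have "bounded (range (P y))"
      by (rule bounded_subset) (use c in \<open>auto simp: Pg\<close>)
    ultimately show ?thesis
      by (simp add: bcontfun_def)
  qed
  then have P: "apply_bcontfun (Bcontfun (P y)) = P y" for y
    by (simp add: Bcontfun_inverse)
  have "\<exists>!y. Bcontfun (P y) = y"
  proof (rule banach_fix_type)
    show "0 \<le> K * \<tau>" "K * \<tau> < 1"
      using \<tau> lipschitz_on_nonneg[OF f] by auto
    have "dist (P y t) (P z t) \<le> K * \<tau> * dist y z" for y z t
    proof -
      have "norm (f (y s) - f (z s)) \<le> K * dist y z" for s
      proof -
        have "norm (f (y s) - f (z s)) \<le> K * dist (y s) (z s)"
          using lipschitz_onD[OF f, of "y s" "z s"] by (simp add: dist_norm)
        then show ?thesis
          by (rule order_trans) (intro mult_left_mono dist_bounded lipschitz_on_nonneg[OF f])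
      qed
      then have "norm (integral {0..c t} (\<lambda>s. f (y s) - f (z s))) \<le> K * dist y z * (c t - 0)"
        using c[of t] by (intro integral_bound continuous_intros cont) auto
      also have "\<dots> \<le> K * dist y z * \<tau>"
        using c[of t] lipschitz_on_nonneg[OF f] by (intro mult_left_mono) auto
      finally show ?thesis
        by (simp add: P_def dist_norm integral_diff int mult_ac)
    qed
    then show "\<forall>y z. dist (Bcontfun (P y)) (Bcontfun (P z)) \<le> K * \<tau> * dist y z"
      by (auto intro!: dist_bound simp: P)
  qed
  then obtain y where "Bcontfun (P y) = y"
    by blast
  then have y: "apply_bcontfun y = P y"
    using P by metis
  have "(P y has_vector_derivative f (y t)) (at t within {0..\<tau>})" if t: "t \<in> {0..\<tau>}" for t
  proof -
    have "((\<lambda>t. x0 + integral {0..t} (\<lambda>s. f (y s))) has_vector_derivative f (y t)) (at t within {0..\<tau>})"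
      using has_vector_derivative_add[OF has_vector_derivative_const[of x0]
          integral_has_vector_derivative[OF cont t]] by simp
    then show ?thesis
      by (rule has_vector_derivative_transform[OF t, rotated]) (auto simp: P_def c_def)
  qed
  moreover have "y 0 = x0"
    unfolding y using \<tau> by (simp add: P_def c_def)
  ultimately show ?thesis
    using that[of "apply_bcontfun y"] y by metis
qed

text \<open>Retracting onto a ball makes the field globally Lipschitz; the solution of the retracted
  equation does not leave the ball for a short time.\<close>

lemma picard_C1:
  fixes f :: "'a::euclidean_space \<Rightarrow> 'a"
  assumes f: "C_k_on 1 f UNIV"
  obtains \<tau> y where "\<tau> > 0" "y 0 = x0"
    "\<And>t. t \<in> {0..\<tau>} \<Longrightarrow> (y has_vector_derivative f (y t)) (at t within {0..\<tau>})"
proof -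
  define r where "r = closest_point (cball x0 1)"
  have r: "1-lipschitz_on UNIV r"
    unfolding r_def by (intro lipschitz_onI) (auto intro!: closest_point_lipschitz)
  have r_in: "r x \<in> cball x0 1" for x
    unfolding r_def by (rule closest_point_in_set) auto
  obtain B where B: "B-lipschitz_on (cball x0 1) f"
    using C1_lipschitz_on[OF f] by (metis compact_cball convex_cball)
  have "(B * 1)-lipschitz_on UNIV (f \<circ> r)"
    using lipschitz_on_compose[OF r] lipschitz_on_subset[OF B, of "range r"] r_in by blast
  then have lip: "B-lipschitz_on UNIV (f \<circ> r)"
    by simp
  have "bounded (f ` cball x0 1)"
    using C1_continuous_on[OF f] by (simp add: compact_continuous_image compact_imp_bounded)
  then obtain M where M: "M > 0" "\<And>x. norm (f (r x)) \<le> M"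
    using r_in by (auto simp: bounded_pos)
  have B0: "B \<ge> 0"
    using lipschitz_on_nonneg[OF B] .
  \<comment> \<open>Short enough both for the contraction, \<open>B * \<tau> < 1\<close>, and for
    speed at most \<open>M\<close> to cover a distance of at most 1.\<close>
  define \<tau> where "\<tau> = 1 / (B + M + 1)"
  have \<tau>: "\<tau> > 0" "B * \<tau> < 1" "M * \<tau> \<le> 1"
    using B0 M by (auto simp: \<tau>_def field_simps)
  obtain y where y: "y 0 = x0"
    "\<And>t. t \<in> {0..\<tau>} \<Longrightarrow> (y has_vector_derivative (f \<circ> r) (y t)) (at t within {0..\<tau>})"
    using picard_lipschitz[OF lip \<tau>(1,2)] by metis
  have "f (r (y t)) = f (y t)" if t: "t \<in> {0..\<tau>}" for t
  proof -
    have "norm (y t - y 0) \<le> M * norm (t - 0)"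
    proof (rule has_vector_derivative_bound[of "{0..\<tau>}" y "\<lambda>t. f (r (y t))"])
      show "(y has_vector_derivative f (r (y s))) (at s within {0..\<tau>})" if "s \<in> {0..\<tau>}" for s
        using y(2)[OF that] by simp
    qed (use t \<tau> M in auto)
    also have "\<dots> \<le> M * \<tau>"
      using M t by (auto intro!: mult_left_mono)
    finally have "y t \<in> cball x0 1"
      using \<tau> y(1) by (simp add: dist_norm norm_minus_commute)
    then show ?thesis
      by (simp add: r_def closest_point_self)
  qed
  then show ?thesis
    using that[of \<tau> y] \<tau>(1) y by simp
qed

lemma forward_solution_continuous_on:
  assumes "forward_solution f J x"
  shows "continuous_on J x"
  using assms by (auto simp: forward_solution_def continuous_on_eq_continuous_within
      intro: has_vector_derivative_continuous)

text \<open>A local solution starting at the end value \<open>x b\<close> is shifted in time by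
  \<open>b\<close> and glued on.\<close>

lemma forward_solution_Icc_extend:
  fixes f :: "'a::euclidean_space \<Rightarrow> 'a"
  assumes f: "C_k_on 1 f UNIV" and x: "forward_solution f {0..b} x"
  obtains b' y where "b' > b" "forward_solution f {0..b'} y" "\<And>t. t \<in> {0..b} \<Longrightarrow> y t = x t"
proof -
  have b: "b \<ge> 0"
    using x by (auto simp: forward_solution_def)
  obtain \<tau> z where \<tau>: "\<tau> > 0" and z: "z 0 = x b"
    "\<And>t. t \<in> {0..\<tau>} \<Longrightarrow> (z has_vector_derivative f (z t)) (at t within {0..\<tau>})"
    using picard_C1[OF f] by metis
  have zd: "((\<lambda>t. z (t - b)) has_vector_derivative f (z (t - b))) (at t within {b..b+\<tau>})"
    if t: "t \<in> {b..b+\<tau>}" for t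
  proof -
    have im: "(\<lambda>t. t - b) ` {b..b+\<tau>} = {0..\<tau>}"
      using image_add_atLeastAtMost[of "- b" b "b + \<tau>"] by simp
    have "((z \<circ> (\<lambda>t. t - b)) has_vector_derivative 1 *\<^sub>R f (z (t - b))) (at t within {b..b+\<tau>})"
      by (rule vector_diff_chain_within) (use t z(2)[of "t - b"] im in \<open>auto intro!: derivative_eq_intros\<close>)
    then show ?thesis
      by (simp add: o_def)
  qed
  define y where "y t = (if t \<in> {0..b} then x t else z (t - b))" for t
  have "(y has_vector_derivative f (y t)) (at t within {0..b+\<tau>})" if t: "t \<in> {0..b+\<tau>}" for t
  proof -
    \<comment> \<open>The two closed intervals meet only at \<open>b\<close>, where both pieces have
      value \<open>x b\<close> and one-sided derivative \<open>f (x b)\<close>.\<close>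
    have "((\<lambda>t. if t \<in> {0..b} then x t else z (t - b)) has_vector_derivative
        (if t \<in> {0..b} then f (x t) else f (z (t - b)))) (at t within {0..b+\<tau>})"
    proof (rule has_vector_derivative_If_within_closures[where T = "{b..b+\<tau>}"])
      have *: "{0..b} \<union> (closure {0..b} \<inter> closure {b..b+\<tau>}) = {0..b}"
        "{b..b+\<tau>} \<union> (closure {0..b} \<inter> closure {b..b+\<tau>}) = {b..b+\<tau>}"
        using b \<tau> by auto
      show "(x has_vector_derivative f (x t))
          (at t within {0..b} \<union> (closure {0..b} \<inter> closure {b..b+\<tau>}))"
        if "t \<in> {0..b} \<union> (closure {0..b} \<inter> closure {b..b+\<tau>})"
        using that x unfolding * by (auto simp: forward_solution_def)
      show "((\<lambda>t. z (t - b)) has_vector_derivative f (z (t - b)))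
          (at t within {b..b+\<tau>} \<union> (closure {0..b} \<inter> closure {b..b+\<tau>}))"
        if "t \<in> {b..b+\<tau>} \<union> (closure {0..b} \<inter> closure {b..b+\<tau>})"
        using that zd unfolding * by auto
    qed (use t b \<tau> z in auto)
    then show ?thesis
      unfolding y_def by (auto cong: if_cong simp: if_distrib split: if_splits)
  qed
  then have "forward_solution f {0..b+\<tau>} y"
    using b \<tau> by (auto simp: forward_solution_def)
  then show ?thesis
    using that[of "b + \<tau>" y] \<tau> by (auto simp: y_def)
qed

text \<open>Inside a compact set the velocity is bounded, so the solution is uniformly continuous
  and has a limit at \<open>b\<close>. Continuity of \<open>f\<close> then suffices for the
  extension to be a solution.\<close>

lemma forward_solution_Ico_extend:
  fixes f :: "'a::euclidean_space \<Rightarrow> 'a"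
  assumes f: "continuous_on UNIV f" and x: "forward_solution f {0..<b} x" and b: "b > 0"
    and K: "compact K" "\<And>t. t \<in> {0..<b} \<Longrightarrow> x t \<in> K"
  obtains y where "forward_solution f {0..b} y" "\<And>t. t \<in> {0..<b} \<Longrightarrow> y t = x t"
proof -
  have der: "(x has_vector_derivative f (x t)) (at t within {0..<b})" if "t \<in> {0..<b}" for t
    using x that by (auto simp: forward_solution_def)
  have "bounded (f ` K)"
    using f K(1) by (meson compact_continuous_image compact_imp_bounded continuous_on_subset subset_UNIV)
  then obtain M where M: "M > 0" "\<And>x. x \<in> K \<Longrightarrow> norm (f x) \<le> M"
    by (auto simp: bounded_pos)
  have "M-lipschitz_on {0..<b} x"
  proof (rule lipschitz_onI)
    show "dist (x s) (x t) \<le> M * dist s t" if "s \<in> {0..<b}" "t \<in> {0..<b}" for s t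
      unfolding dist_norm
      by (rule has_vector_derivative_bound[of "{0..<b}" x "\<lambda>t. f (x t)"])
        (use that der M K in auto)
  qed (use M in auto)
  then obtain y where "uniformly_continuous_on (closure {0..<b}) y"
    and yx: "\<And>t. t \<in> {0..<b} \<Longrightarrow> x t = y t"
    using uniformly_continuous_on_extension_on_closure lipschitz_on_uniformly_continuous by metis
  then have y: "continuous_on {0..b} y"
    using b uniformly_continuous_imp_continuous by force
  have yd: "(y has_vector_derivative f (y t)) (at t)" if t: "t \<in> {0<..<b}" for t
  proof -
    have "(x has_vector_derivative f (x t)) (at t within {0<..<b})"
      by (rule has_vector_derivative_within_subset[OF der]) (use t in auto)
    then have "(x has_vector_derivative f (x t)) (at t)"
      using t by (simp add: at_within_open[of t "{0<..<b}"])
    then have "(y has_vector_derivative f (x t)) (at t)"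
      by (rule has_vector_derivative_transform_within_open[where S = "{0<..<b}"]) (use t yx in auto)
    then show ?thesis
      using t yx[of t] by simp
  qed
  have fy: "continuous_on {0..b} (\<lambda>t. f (y t))"
    using continuous_on_compose2[OF f y] by auto
  \<comment> \<open>The derivative of \<open>y\<close> is known only in the open interval so far.
    The integral equation needs no more than that, and differentiating it yields the one-sided
    derivatives at the endpoints.\<close>
  have eq: "y t = y 0 + integral {0..t} (\<lambda>s. f (y s))" if t: "t \<in> {0..b}" for t
  proof -
    have "((\<lambda>s. f (y s)) has_integral (y t - y 0)) {0..t}"
      using t y yd by (intro fundamental_theorem_of_calculus_interior)
        (auto intro: continuous_on_subset)
    then show ?thesis
      by (simp add: integral_unique)
  qed
  have "(y has_vector_derivative f (y t)) (at t within {0..b})" if t: "t \<in> {0..b}" for t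
  proof -
    have "((\<lambda>t. y 0 + integral {0..t} (\<lambda>s. f (y s))) has_vector_derivative f (y t)) (at t within {0..b})"
      using has_vector_derivative_add[OF has_vector_derivative_const[of "y 0"]
          integral_has_vector_derivative[OF fy t]] by simp
    then show ?thesis
      by (rule has_vector_derivative_transform[OF t, rotated]) (rule eq)
  qed
  then have "forward_solution f {0..b} y"
    using b by (auto simp: forward_solution_def)
  then show ?thesis
    using that yx by metis
qed

text \<open>Otherwise \<open>J\<close> is bounded and equals \<open>{0..b}\<close> or
  \<open>{0..<b}\<close>. Local existence extends the solution in the first case, compactness of
  \<open>K\<close> supplies the end value in the second; both contradict maximality.\<close>

lemma trajectory_in_compact_complete:
  fixes f :: "'a::euclidean_space \<Rightarrow> 'a"
  assumes f: "C_k_on 1 f UNIV" and x: "trajectory f J x"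
    and K: "compact K" "\<And>t. t \<in> J \<Longrightarrow> x t \<in> K"
  shows "J = {0..}"
proof (rule ccontr)
  assume ne: "J \<noteq> {0..}"
  have sol: "forward_solution f J x"
    using x by (simp add: trajectory_def)
  have max: "J' = J" if "forward_solution f J' y" "J \<subseteq> J'" "\<forall>t\<in>J. y t = x t" for J' y
  proof -
    have "\<forall>J' y. forward_solution f J' y \<and> J \<subseteq> J' \<and> (\<forall>t\<in>J. y t = x t) \<longrightarrow> J' = J"
      using x unfolding trajectory_def by (rule conjunct2)
    then show ?thesis
      using that by (elim allE[of _ J'] allE[of _ y]) simp
  qed
  have J: "0 \<in> J" "J \<subseteq> {0..}"
    using sol by (simp_all add: forward_solution_def)
  have int: "t \<in> J" if "a \<in> J" "b \<in> J" "a \<le> t" "t \<le> b" for a b t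
    using sol that unfolding forward_solution_def is_interval_1 by blast
  obtain T where T: "T \<ge> 0" "T \<notin> J"
    using ne J by auto
  have bdd: "bdd_above J"
  proof (rule bdd_aboveI)
    show "t \<le> T" if "t \<in> J" for t
      using T int[OF J(1) that, of T] by force
  qed
  define b where "b = Sup J"
  have le: "t \<le> b" if "t \<in> J" for t
    using cSup_upper[OF that bdd] by (simp add: b_def)
  have lt: "t \<in> J" if t: "0 \<le> t" "t < b" for t
  proof -
    obtain s where "s \<in> J" "t < s"
      using less_cSupD[of J t] t(2) J(1) unfolding b_def by blast
    then show ?thesis
      using int[OF J(1), of s t] t(1) by simp
  qed
  show False
  proof (cases "b \<in> J")
    case True
    have Jb: "J = {0..b}"
    proof (intro equalityI subsetI)
      show "t \<in> {0..b}" if "t \<in> J" for t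
        using le[OF that] J(2) that by auto
      show "t \<in> J" if "t \<in> {0..b}" for t
        using int[OF J(1) True, of t] that by simp
    qed
    obtain b' y where "b' > b" "forward_solution f {0..b'} y" "\<And>t. t \<in> {0..b} \<Longrightarrow> y t = x t"
      using forward_solution_Icc_extend[OF f] sol Jb by metis
    moreover from this have "{0..b'} = J"
      by (intro max) (auto simp: Jb)
    ultimately show False
      using le J(1) by force
  next
    case False
    have Jb: "J = {0..<b}"
    proof (intro equalityI subsetI)
      show "t \<in> {0..<b}" if "t \<in> J" for t
        using le[OF that] J(2) that False by (cases "t = b") auto
      show "t \<in> J" if "t \<in> {0..<b}" for t
        using lt that by simp
    qed
    then have "b > 0"
      using J by auto
    then obtain y where "forward_solution f {0..b} y" "\<And>t. t \<in> {0..<b} \<Longrightarrow> y t = x t"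
      using forward_solution_Ico_extend[OF C1_continuous_on[OF f] _ _ K(1)] sol K(2) Jb by metis
    then have "{0..b} = J"
      by (intro max) (auto simp: Jb)
    then show False
      using False \<open>b > 0\<close> by force
  qed
qed


section \<open>Lyapunov functions\<close>

lemma forward_solution_chain:
  assumes x: "forward_solution f J x" and t: "t \<in> J" and H: "(H has_derivative H') (at (x t))"
  shows "((\<lambda>t. H (x t)) has_real_derivative H' (f (x t))) (at t within J)"
proof -
  have "(x has_derivative (\<lambda>h. h *\<^sub>R f (x t))) (at t within J)"
    using x t by (auto simp: forward_solution_def has_vector_derivative_def)
  then have "((\<lambda>t. H (x t)) has_derivative (\<lambda>h. H' (h *\<^sub>R f (x t)))) (at t within J)"
    by (rule has_derivative_compose[where f = x and g = H and g' = H', OF _ H])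
  moreover have "H' (h *\<^sub>R f (x t)) = H' (f (x t)) * h" for h
    using linear_cmul[OF has_derivative_linear[OF H], of h "f (x t)"] by simp
  ultimately show ?thesis
    by (simp add: has_field_derivative_def)
qed

text \<open>First-exit argument, without uniqueness of solutions. At the supposed exit time the
  solution is in the interior of \<open>D\<close>, and either \<open>H < a\<close> persists by
  continuity or \<open>H = a\<close> and the negative derivative pushes it back in.\<close>

lemma sublevel_positively_invariant:
  fixes f :: "'a::real_normed_vector \<Rightarrow> 'a" and H :: "'a \<Rightarrow> real"
  assumes H: "continuous_on UNIV H" and D: "closed D"
    and sub: "{x\<in>D. H x \<le> a} \<subseteq> interior D"
    and der: "\<And>x. x \<in> D \<Longrightarrow> H x = a \<Longrightarrow> (H has_derivative H' x) (at x)"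
    and neg: "\<And>x. x \<in> D \<Longrightarrow> H x = a \<Longrightarrow> H' x (f x) < 0"
  shows "positively_invariant f {x\<in>D. H x \<le> a}"
  unfolding positively_invariant_def
proof (intro allI impI ballI, elim conjE)
  fix J x T
  assume x: "forward_solution f J x" and x0: "x 0 \<in> {x\<in>D. H x \<le> a}" and T: "T \<in> J"
  define \<Omega> where "\<Omega> = {x\<in>D. H x \<le> a}"
  have J: "0 \<in> J" "J \<subseteq> {0..}"
    using x by (simp_all add: forward_solution_def)
  then have T0: "T \<ge> 0"
    using T by auto
  have int: "t \<in> J" if "0 \<le> t" "t \<le> T" for t
    using x T that unfolding forward_solution_def is_interval_1 by blast
  have contx: "continuous_on J x"
    using forward_solution_continuous_on[OF x] .
  have "closed {x. H x \<le> a}"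
    using H by (intro closed_Collect_le continuous_intros) auto
  then have "closed \<Omega>"
    using D closed_Int[of D "{x. H x \<le> a}"] by (simp add: \<Omega>_def Collect_conj_eq)
  \<comment> \<open>Times up to which the solution has never left \<open>\<Omega>\<close>; the goal
    becomes \<open>Sup S = T\<close>.\<close>
  define S where "S = {t\<in>{0..T}. \<forall>s\<in>{0..t}. x s \<in> \<Omega>}"
  define s where "s = Sup S"
  have S0: "0 \<in> S" and bdd: "bdd_above S"
    using x0 T0 by (auto simp: S_def \<Omega>_def intro: bdd_aboveI[of _ T])
  have "0 \<le> s"
    using cSup_upper[OF S0 bdd] by (simp add: s_def)
  moreover have "s \<le> T"
    unfolding s_def by (rule cSup_least) (use S0 in \<open>auto simp: S_def\<close>)
  ultimately have s: "0 \<le> s" "s \<le> T"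
    by simp_all
  have before: "x t \<in> \<Omega>" if "0 \<le> t" and ts: "t < s" for t
  proof -
    obtain s' where "s' \<in> S" "t < s'"
      using less_cSupD[of S t] ts S0 unfolding s_def by blast
    then show ?thesis
      using \<open>0 \<le> t\<close> by (simp add: S_def)
  qed
  have xs: "x s \<in> \<Omega>"
  proof (cases "s = 0")
    case True
    then show ?thesis using x0 by (simp add: \<Omega>_def)
  next
    case False
    have "continuous_on {0..s} x"
      using contx int s by (auto intro: continuous_on_subset)
    moreover have "x ` {0..<s} \<subseteq> \<Omega>"
      using before by auto
    ultimately have "x ` closure {0..<s} \<subseteq> \<Omega>"
      using image_closure_subset[of "{0..<s}" x \<Omega>] \<open>closed \<Omega>\<close> False s by force
    then show ?thesis
      using False s by force
  qed
  \<comment> \<open>Membership in \<open>D\<close> and the bound on \<open>H\<close> are continued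
    past \<open>s\<close> separately, then the smaller time step is taken.\<close>
  have "\<exists>e>0. \<forall>t\<in>J. s < t \<longrightarrow> t < s + e \<longrightarrow> x t \<in> \<Omega>"
  proof -
    have right: "\<exists>e>0. \<forall>t\<in>J. s < t \<longrightarrow> t < s + e \<longrightarrow> P t" if ev: "\<forall>\<^sub>F t in at s within J. P t" for P
    proof -
      obtain e where e: "e > 0" "\<And>t. t \<in> J \<Longrightarrow> t \<noteq> s \<Longrightarrow> dist t s < e \<Longrightarrow> P t"
        using ev unfolding eventually_at by blast
      have "P t" if "t \<in> J" "s < t" "t < s + e" for t
        using e(2)[of t] that by (simp add: dist_real_def)
      then show ?thesis
        using e(1) by blast
    qed
    have sJ: "s \<in> J"
      using int s by auto
    then have lim: "(x \<longlongrightarrow> x s) (at s within J)"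
      using contx by (auto simp: continuous_on)
    have "x s \<in> interior D"
      using xs sub by (auto simp: \<Omega>_def)
    then have "\<forall>\<^sub>F t in at s within J. x t \<in> interior D"
      using topological_tendstoD[OF lim] by auto
    then have evD: "\<forall>\<^sub>F t in at s within J. x t \<in> D"
      by eventually_elim (use interior_subset in auto)
    have evH: "\<exists>e>0. \<forall>t\<in>J. s < t \<longrightarrow> t < s + e \<longrightarrow> H (x t) \<le> a"
    proof (cases "H (x s) = a")
      case True
      have xD: "x s \<in> D"
        using xs by (auto simp: \<Omega>_def)
      from has_real_derivative_neg_dec_right[OF forward_solution_chain[OF x sJ der[OF xD True]] neg[OF xD True]]
      obtain e where e: "e > 0" "\<And>h. h > 0 \<Longrightarrow> s + h \<in> J \<Longrightarrow> h < e \<Longrightarrow> H (x (s + h)) < H (x s)"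
        by blast
      have "H (x t) \<le> a" if "t \<in> J" "s < t" "t < s + e" for t
        using e(2)[of "t - s"] that True by simp
      then show ?thesis
        using e(1) by blast
    next
      case False
      then have "H (x s) < a"
        using xs by (auto simp: \<Omega>_def)
      moreover have "((\<lambda>t. H (x t)) \<longlongrightarrow> H (x s)) (at s within J)"
        by (rule continuous_on_tendsto_compose[OF H lim]) auto
      ultimately have "\<forall>\<^sub>F t in at s within J. H (x t) < a"
        using order_tendstoD by blast
      then show ?thesis
        using right[of "\<lambda>t. H (x t) < a"] less_imp_le by blast
    qed
    obtain e1 where e1: "e1 > 0" "\<And>t. t \<in> J \<Longrightarrow> s < t \<Longrightarrow> t < s + e1 \<Longrightarrow> x t \<in> D"
      using right[OF evD] by blast
    obtain e2 where e2: "e2 > 0" "\<And>t. t \<in> J \<Longrightarrow> s < t \<Longrightarrow> t < s + e2 \<Longrightarrow> H (x t) \<le> a"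
      using evH by blast
    show ?thesis
      using e1 e2 by (intro exI[of _ "min e1 e2"]) (auto simp: \<Omega>_def)
  qed
  then obtain e where e: "e > 0" "\<And>t. t \<in> J \<Longrightarrow> s < t \<Longrightarrow> t < s + e \<Longrightarrow> x t \<in> \<Omega>"
    by blast
  have "s = T"
  proof (rule ccontr)
    assume "s \<noteq> T"
    define t where "t = min T (s + e / 2)"
    have t: "s < t" "t \<le> T" "t < s + e"
      using \<open>s \<noteq> T\<close> s e(1) by (auto simp: t_def)
    have "x u \<in> \<Omega>" if "u \<in> {0..t}" for u
      using that before[of u] xs e(2)[of u] int[of u] t by (cases u s rule: linorder_cases) auto
    then have "t \<in> S"
      using t s by (auto simp: S_def)
    then show False
      using cSup_upper[OF _ bdd] t by (force simp: s_def)
  qed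
  then show "x T \<in> {x\<in>D. H x \<le> a}"
    using xs by (simp add: \<Omega>_def)
qed

text \<open>While \<open>H\<close> stays above a positive level, the trajectory avoids a ball around
  the origin, so \<open>decay\<close> forces \<open>H\<close> down linearly, which cannot last
  forever. Low levels of \<open>H\<close> within the compact set lie near the origin.\<close>

lemma lyapunov_trajectories_converge:
  fixes f :: "'a::euclidean_space \<Rightarrow> 'a" and H :: "'a \<Rightarrow> real"
  assumes f: "C_k_on 1 f UNIV" "f 0 = 0"
    and \<Omega>: "compact \<Omega>" "positively_invariant f \<Omega>"
    and H0: "H 0 = 0" and Hpos: "\<And>x. x \<noteq> 0 \<Longrightarrow> H x > 0"
    and der: "\<And>x. (H has_derivative H' x) (at x)"
    and decay: "\<And>r s. r > 0 \<Longrightarrow> s > 0 \<Longrightarrow> \<exists>\<gamma>>0. \<forall>x\<in>\<Omega>. r \<le> norm x \<longrightarrow> s \<le> H x \<longrightarrow> H' x (f x) \<le> - \<gamma>"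
  shows "trajectories_from_converge_to_origin f \<Omega>"
  unfolding trajectories_from_converge_to_origin_def
proof (intro allI impI, elim conjE)
  fix J x
  assume x: "trajectory f J x" and x0: "x 0 \<in> \<Omega>"
  have sol: "forward_solution f J x"
    using x by (simp add: trajectory_def)
  then have in\<Omega>: "x t \<in> \<Omega>" if "t \<in> J" for t
    using \<Omega>(2) x0 that by (auto simp: positively_invariant_def)
  have J: "J = {0..}"
    using trajectory_in_compact_complete[OF f(1) x \<Omega>(1)] in\<Omega> by blast
  have cont: "continuous_on S H" for S
    using der has_derivative_continuous_on has_derivative_at_withinI by metis
  have H_nonneg: "H x \<ge> 0" for x
    using H0 Hpos[of x] by (cases "x = 0") auto
  \<comment> \<open>\<open>decay\<close> is used with the thresholds \<open>norm x\<close> and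
    \<open>H x\<close> of the point itself; the origin is an equilibrium.\<close>
  have neg: "H' x (f x) \<le> 0" if "x \<in> \<Omega>" for x
  proof (cases "x = 0")
    case True
    then show ?thesis
      using f(2) linear_0[OF has_derivative_linear[OF der]] by simp
  next
    case False
    then show ?thesis
      using decay[of "norm x" "H x"] Hpos that by force
  qed
  define h where "h t = H (x t)" for t
  have h: "(h has_real_derivative H' (x t) (f (x t))) (at t within {0..})" if "t \<ge> 0" for t
    unfolding h_def using forward_solution_chain[OF sol _ der] that J by auto
  \<comment> \<open>Because \<open>h u + \<gamma> * u\<close> is nonincreasing. Used with a positive
    rate for the linear decrease and with rate 0 for monotonicity.\<close>
  have decr: "h t \<le> h s - \<gamma> * (t - s)"
    if st: "0 \<le> s" "s \<le> t" and \<gamma>: "\<And>u. s \<le> u \<Longrightarrow> u \<le> t \<Longrightarrow> H' (x u) (f (x u)) \<le> - \<gamma>" for s t \<gamma>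
  proof -
    have "h t + \<gamma> * t \<le> h s + \<gamma> * s"
    proof (rule DERIV_nonpos_imp_decreasing_open[where f = "\<lambda>u. h u + \<gamma> * u", OF st(2)])
      fix u assume u: "s < u" "u < t"
      have "(h has_real_derivative H' (x u) (f (x u))) (at u within {0<..})"
        using h[of u] u st by (auto intro: has_field_derivative_subset)
      then have "(h has_real_derivative H' (x u) (f (x u))) (at u)"
        using u st by (simp add: at_within_open[of u "{0<..}"])
      then have "((\<lambda>u. h u + \<gamma> * u) has_real_derivative H' (x u) (f (x u)) + \<gamma>) (at u)"
        by (auto intro!: derivative_eq_intros)
      moreover have "H' (x u) (f (x u)) + \<gamma> \<le> 0"
        using \<gamma>[of u] u by simp
      ultimately show "\<exists>y. ((\<lambda>u. h u + \<gamma> * u) has_real_derivative y) (at u) \<and> y \<le> 0"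
        by blast
    next
      have "continuous_on {0..} h"
        by (rule DERIV_continuous_on[where D = "\<lambda>t. H' (x t) (f (x t))"]) (use h in auto)
      then have "continuous_on {s..t} h"
        using st by (auto intro: continuous_on_subset)
      then show "continuous_on {s..t} (\<lambda>u. h u + \<gamma> * u)"
        by (intro continuous_intros)
    qed
    then show ?thesis
      by (simp add: algebra_simps)
  qed
  have "\<forall>\<^sub>F t in at_top. norm (x t) < e" if e: "e > 0" for e
  proof -
    \<comment> \<open>The minimum of \<open>H\<close> over the part of \<open>\<Omega>\<close>
      outside the open \<open>e\<close>-ball, or 1 if that part is empty. Reaching a level below
      \<open>h0\<close> thus means entering the ball.\<close>
    obtain h0 where h0: "h0 > 0" "\<And>x. x \<in> \<Omega> \<Longrightarrow> norm x \<ge> e \<Longrightarrow> H x \<ge> h0"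
    proof -
      define K where "K = \<Omega> - ball 0 e"
      have "compact K"
        unfolding K_def using \<Omega>(1) by (intro compact_diff) auto
      show ?thesis
      proof (cases "K = {}")
        case True
        then have "norm x < e" if "x \<in> \<Omega>" for x
          using that by (auto simp: K_def)
        then show ?thesis
          using that[of 1] by fastforce
      next
        case False
        then obtain y where y: "y \<in> K" "\<And>x. x \<in> K \<Longrightarrow> H y \<le> H x"
          using continuous_attains_inf[OF \<open>compact K\<close> _ cont] by blast
        then have "y \<noteq> 0"
          using e by (auto simp: K_def)
        then show ?thesis
          using that[of "H y"] Hpos y(2) by (simp add: K_def)
      qed
    qed
    have "\<exists>T\<ge>0. h T < h0"
    proof (rule ccontr)
      assume "\<not> ?thesis"
      then have ge: "h t \<ge> h0" if "t \<ge> 0" for t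
        using that by force
      \<comment> \<open>Continuity at the origin turns the lower bound \<open>h0\<close> on
        \<open>H\<close> into a lower bound \<open>r\<close> on the norm, the second threshold of
        \<open>decay\<close>.\<close>
      have "isCont H 0"
        using cont[of UNIV] by (simp add: continuous_on_eq_continuous_at)
      then obtain r where r: "r > 0" "\<And>x. norm x < r \<Longrightarrow> \<bar>H x\<bar> < h0"
        using h0(1) H0 unfolding continuous_at_eps_delta by (auto simp: dist_norm)
      obtain \<gamma> where \<gamma>: "\<gamma> > 0" "\<And>x. x \<in> \<Omega> \<Longrightarrow> r \<le> norm x \<Longrightarrow> h0 \<le> H x \<Longrightarrow> H' x (f x) \<le> - \<gamma>"
        using decay[OF r(1) h0(1)] by blast
      \<comment> \<open>By this time the linear bound has dropped to -1, contradicting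
        \<open>h t \<ge> h0 > 0\<close>.\<close>
      define t where "t = (h 0 + 1) / \<gamma>"
      have t: "t \<ge> 0" "\<gamma> * t = h 0 + 1"
        using \<gamma>(1) H_nonneg[of "x 0"] by (auto simp: t_def h_def)
      have "h t \<le> h 0 - \<gamma> * (t - 0)"
      proof (rule decr)
        fix u :: real assume u: "0 \<le> u"
        show "H' (x u) (f (x u)) \<le> - \<gamma>"
        proof (rule \<gamma>(2))
          show "x u \<in> \<Omega>"
            using u J by (intro in\<Omega>) simp
          show "h0 \<le> H (x u)"
            using ge[OF u] by (simp add: h_def)
          then show "r \<le> norm (x u)"
            using r(2)[of "x u"] by (cases "norm (x u) < r") auto
        qed
      qed (use t in auto)
      then show False
        using t ge[of t] h0(1) by simp
    qed
    then obtain T where T: "T \<ge> 0" "h T < h0"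
      by blast
    have "norm (x t) < e" if "t \<ge> T" for t
    proof -
      have "h t \<le> h T - 0 * (t - T)"
        using T that J in\<Omega> neg by (intro decr) auto
      then show ?thesis
        using h0(2)[of "x t"] T in\<Omega>[of t] that J by (cases "norm (x t) < e") (auto simp: h_def)
    qed
    then show ?thesis
      by (auto simp: eventually_at_top_linorder)
  qed
  then have "(x \<longlongrightarrow> 0) at_top"
    by (auto simp: tendsto_iff)
  with J show "J = {0..} \<and> (x \<longlongrightarrow> 0) at_top"
    by simp
qed


section \<open>The orbital derivative of the network Lyapunov function\<close>

lemma differentiable_tanh:
  fixes g :: "'a::real_normed_vector \<Rightarrow> real"
  assumes "g differentiable (at x)"
  shows "(\<lambda>y. tanh (g y)) differentiable (at x)"
proof -
  have "(tanh has_real_derivative 1 - tanh (g x) ^ 2) (at (g x))"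
    by (auto intro!: derivative_eq_intros)
  then show ?thesis
    using assms DERIV_compose_FDERIV unfolding differentiable_def by blast
qed

lemma activation_differentiable: "(\<lambda>y. activation m \<theta> l y i) differentiable (at x)"
proof (induction l arbitrary: i)
  case 0
  have "(\<lambda>y. in_weight \<theta> i \<bullet> y + hid_bias \<theta> 0 i) differentiable (at x)"
    by (intro derivative_intros bounded_linear_imp_differentiable bounded_linear_inner_right)
  then show ?case
    by (simp add: differentiable_tanh)
next
  case (Suc l)
  have "(\<lambda>y. (\<Sum>j<m ! l. hid_weight \<theta> (Suc l) i j * activation m \<theta> l y j) + hid_bias \<theta> (Suc l) i)
      differentiable (at x)"
    by (intro differentiable_add differentiable_sum differentiable_mult differentiable_const ballI Suc
        finite_lessThan)
  then show ?case
    by (simp add: differentiable_tanh)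
qed

lemma G_net_differentiable: "G_net m \<theta> differentiable (at x)"
  unfolding G_net_def[abs_def] net_def
  by (intro differentiable_diff differentiable_add differentiable_sum differentiable_mult
      differentiable_const ballI activation_differentiable finite_lessThan)

section \<open>Scaling of logarithmic derivatives and the estimate near the origin\<close>

text \<open>Homogeneity gives \<open>ln (V (r *\<^sub>R y)) = p * ln r + ln (V y)\<close> off the
  origin, so the logarithmic derivative is homogeneous of degree -1, whatever the degree
  \<open>p\<close>.\<close>

lemma ln_homogeneous_derivative:
  fixes V :: "'a::real_normed_vector \<Rightarrow> real"
  assumes V: "homogeneous p V" and pos: "\<And>x. x \<noteq> 0 \<Longrightarrow> V x > 0" and r: "r > 0" and u: "u \<noteq> 0"
    and A: "((\<lambda>y. ln (V y)) has_derivative A) (at (r *\<^sub>R u))"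
  shows "frechet_derivative (\<lambda>y. ln (V y)) (at u) = (\<lambda>v. A (r *\<^sub>R v))"
proof -
  have "((\<lambda>y. ln (V (r *\<^sub>R y))) has_derivative (\<lambda>v. A (r *\<^sub>R v))) (at u)"
    by (rule has_derivative_compose[where f = "\<lambda>y. r *\<^sub>R y" and g = "\<lambda>y. ln (V y)" and g' = A, OF _ A]) (auto intro!: derivative_eq_intros)
  then have "((\<lambda>y. ln (V (r *\<^sub>R y)) - p * ln r) has_derivative (\<lambda>v. A (r *\<^sub>R v) - 0)) (at u)"
    by (intro has_derivative_diff has_derivative_const)
  then have "((\<lambda>y. ln (V y)) has_derivative (\<lambda>v. A (r *\<^sub>R v) - 0)) (at u)"
  proof (rule has_derivative_transform_within_open[of _ _ _ _ "- {0}"])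
    fix y :: 'a assume "y \<in> - {0}"
    then show "ln (V (r *\<^sub>R y)) - p * ln r = ln (V y)"
      using V pos[of y] r by (simp add: homogeneous_def ln_mult ln_powr)
  qed (use u in auto)
  then show ?thesis
    using frechet_derivative_at by force
qed

lemma H_net_differentiable:
  assumes "V differentiable (at x)"
  shows "H_net V m \<theta> differentiable (at x)"
proof -
  have "(\<lambda>y. exp (G_net m \<theta> y)) differentiable (at x)"
    using G_net_differentiable[of m \<theta> x] unfolding differentiable_def by (blast intro: has_derivative_exp)
  then show ?thesis
    unfolding H_net_def[abs_def] using assms by (intro differentiable_mult)
qed

lemma ln_has_derivative_frechet:
  fixes H :: "'a::real_normed_vector \<Rightarrow> real"
  assumes "H differentiable (at x)" "H x > 0"
  shows "((\<lambda>y. ln (H y)) has_derivative (\<lambda>v. frechet_derivative H (at x) v / H x)) (at x)"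
  using has_derivative_ln[OF assms(2) frechet_derivative_works[THEN iffD1, OF assms(1)]]
  by (simp add: divide_inverse mult.commute)

text \<open>Off the origin \<open>ln H = ln V + G\<close>. The powers of \<open>r\<close> combine to
  a single factor \<open>r\<close>, which the degree -1 of the derivative of \<open>ln V\<close>
  absorbs; in front of the derivative of \<open>G\<close> it remains and makes that term
  small.\<close>

lemma \<Phi>_scaled_eq:
  fixes f fd :: "real^'n \<Rightarrow> real^'n" and d :: real
  assumes V: "homogeneous p V" "\<And>x. x \<noteq> 0 \<Longrightarrow> V x > 0" "V differentiable (at (r *\<^sub>R u))"
    and r: "r > 0" and u: "norm u = 1"
  defines "w \<equiv> fd u + E_scaled f fd d r u"
  shows "\<Phi>_scaled f V d m \<theta> (r *\<^sub>R u) =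
    q_row V u w + r * frechet_derivative (G_net m \<theta>) (at (r *\<^sub>R u)) w"
proof -
  define x where "x = r *\<^sub>R u"
  define B where "B = frechet_derivative (G_net m \<theta>) (at x)"
  have u0: "u \<noteq> 0" and x: "x \<noteq> 0" "norm x = r"
    using u r by (auto simp: x_def)
  obtain A where A: "((\<lambda>y. ln (V y)) has_derivative A) (at x)"
    using ln_has_derivative_frechet[OF V(3)] V(2) x unfolding x_def by blast
  have B: "(G_net m \<theta> has_derivative B) (at x)"
    using G_net_differentiable by (simp add: B_def frechet_derivative_works)
  have "((\<lambda>y. ln (V y) + G_net m \<theta> y) has_derivative (\<lambda>v. A v + B v)) (at x)"
    using A B by (rule has_derivative_add)
  then have "((\<lambda>y. ln (H_net V m \<theta> y)) has_derivative (\<lambda>v. A v + B v)) (at x)"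
    by (rule has_derivative_transform_within_open[of _ _ _ _ "- {0}"])
      (use less_imp_neq[OF V(2)] x in \<open>auto simp: H_net_def ln_mult\<close>)
  then have lnH: "frechet_derivative (\<lambda>y. ln (H_net V m \<theta> y)) (at x) = (\<lambda>v. A v + B v)"
    using frechet_derivative_at by force
  have q: "q_row V u = (\<lambda>v. A (r *\<^sub>R v))"
    unfolding q_row_def using ln_homogeneous_derivative[OF V(1,2) r u0] A by (simp add: x_def)
  \<comment> \<open>\<open>fd u\<close> cancels against the one subtracted in
    \<open>E_scaled\<close>, so \<open>w\<close> is the rescaled field itself.\<close>
  have "w = r powr (- d) *\<^sub>R f x"
    by (simp add: w_def E_scaled_def x_def)
  then have fx: "f x = r powr d *\<^sub>R w"
    using r by (simp add: powr_minus)
  have "r powr (1 - d) * A (r powr d *\<^sub>R w) = A (r *\<^sub>R w)" "r powr (1 - d) * B (r powr d *\<^sub>R w) = r * B w"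
    using r by (simp_all add: linear_cmul[OF has_derivative_linear[OF A]]
        linear_cmul[OF has_derivative_linear[OF B]] powr_diff)
  then show ?thesis
    unfolding \<Phi>_scaled_def x_def[symmetric] lnH q fx x(2) B_def[symmetric]
    by (simp add: distrib_left)
qed

text \<open>The leading term is \<open>q_row V u (fd u)\<close>. The remainder \<open>e\<close> seen
  by \<open>q_row\<close> and the whole field \<open>fd u + e\<close> seen by \<open>G\<close> give
  the two error terms; replacing \<open>r\<close> by \<open>\<rho>\<close> makes them uniform on the
  ball.\<close>

lemma \<Phi>_scaled_near_origin:
  assumes V: "homogeneous p V" "\<And>x. x \<noteq> 0 \<Longrightarrow> V x > 0" "\<And>x. V differentiable (at x)"
    and r: "0 < r" "r \<le> \<rho>" and u: "norm u = 1"
    and nonneg: "L \<ge> 0" "\<delta> \<ge> 0" "Mq \<ge> 0" "Md \<ge> 0" "LG \<ge> 0"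
    and q: "q_row V u (fd u) \<le> - \<eta>" "onorm (q_row V u) \<le> Mq"
    and fd: "norm (fd u) \<le> Md"
    and E: "norm (E_scaled f fd d r u) \<le> L * r powr \<delta>"
    and G: "onorm (frechet_derivative (G_net m \<theta>) (at (r *\<^sub>R u))) \<le> LG"
  shows "\<Phi>_scaled f V d m \<theta> (r *\<^sub>R u) \<le>
    - \<eta> + (Mq * L * \<rho> powr \<delta> + \<rho> * LG * (Md + L * \<rho> powr \<delta>))"
proof -
  define e where "e = E_scaled f fd d r u"
  define B where "B = frechet_derivative (G_net m \<theta>) (at (r *\<^sub>R u))"
  have u0: "u \<noteq> 0"
    using u by auto
  have "r powr \<delta> \<le> \<rho> powr \<delta>"
    using r nonneg by (intro powr_mono2) auto
  then have e: "norm e \<le> L * \<rho> powr \<delta>"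
    using E nonneg(1) unfolding e_def by (meson mult_left_mono order_trans)
  have blq: "bounded_linear (q_row V u)"
    unfolding q_row_def using ln_has_derivative_frechet[OF V(3) V(2)[OF u0]]
    by (metis differentiableI frechet_derivative_works has_derivative_bounded_linear)
  have blB: "bounded_linear B"
    unfolding B_def using G_net_differentiable frechet_derivative_works has_derivative_bounded_linear by blast
  have "q_row V u e \<le> Mq * (L * \<rho> powr \<delta>)"
  proof -
    have "q_row V u e \<le> onorm (q_row V u) * norm e"
      using onorm[OF blq, of e] by simp
    also have "\<dots> \<le> Mq * (L * \<rho> powr \<delta>)"
      using q(2) e nonneg by (intro mult_mono) auto
    finally show ?thesis .
  qed
  then have 1: "q_row V u (fd u + e) \<le> - \<eta> + Mq * L * \<rho> powr \<delta>"
    using q(1) linear_add[OF bounded_linear.linear[OF blq]] by simp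
  have "B (fd u + e) \<le> onorm B * norm (fd u + e)"
    using onorm[OF blB, of "fd u + e"] by simp
  also have "\<dots> \<le> LG * (Md + L * \<rho> powr \<delta>)"
    using G fd e nonneg by (intro mult_mono norm_triangle_le add_mono) (auto simp: B_def)
  finally have "r * B (fd u + e) \<le> r * (LG * (Md + L * \<rho> powr \<delta>))"
    using r by (intro mult_left_mono) auto
  also have "\<dots> \<le> \<rho> * (LG * (Md + L * \<rho> powr \<delta>))"
    using r nonneg by (intro mult_right_mono) auto
  finally have "r * B (fd u + e) \<le> \<rho> * LG * (Md + L * \<rho> powr \<delta>)"
    by (simp add: mult.assoc)
  with 1 show ?thesis
    using \<Phi>_scaled_eq[OF V(1,2,3) r(1) u, of f d m \<theta> fd] by (simp add: e_def B_def)
qed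

section \<open>From levels of \<open>W\<close> to levels of \<open>H\<close>, and assembly of the
  estimates\<close>

lemma tanh_real_surj:
  assumes "\<bar>c\<bar> < 1"
  shows "\<exists>a::real. tanh a = c"
proof
  \<comment> \<open>The witness is the inverse hyperbolic tangent of \<open>c\<close> in logarithmic
    form.\<close>
  have "exp (- 2 * (ln ((1 + c) / (1 - c)) / 2)) = (1 - c) / (1 + c)"
    using assms by (simp add: exp_minus)
  moreover have "(1 - (1 - c) / (1 + c)) / (1 + (1 - c) / (1 + c)) = c"
    using assms by (simp add: field_simps)
  ultimately show "tanh (ln ((1 + c) / (1 - c)) / 2) = c"
    by (simp only: tanh_real_altdef)
qed

theorem proposition11:
  fixes f fd :: "real^'n \<Rightarrow> real^'n"
    and V :: "real^'n \<Rightarrow> real"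
    and m :: "nat list" and \<theta> :: "'n net_params"
    and U D :: "(real^'n) set"
    and d \<delta> L p \<mu> \<rho> \<eta> Mq Md LG c \<epsilon> :: real
  assumes "C_k_on 1 f UNIV" and "f 0 = 0"
    and "homogeneous_dominance f fd d \<delta> L U"
    and "p > 1" and "\<mu> > 0" and "local_lyapunov V fd p d \<mu>"
    and "valid_widths m"
    and "\<rho> > 0" and "compact D" and "cball 0 \<rho> \<subseteq> interior D"
    and "cball 0 \<rho> \<subseteq> U"
    and "\<eta> > 0" and "Mq \<ge> 0" and "Md \<ge> 0" and "LG \<ge> 0"
    and "\<And>u. norm u = 1 \<Longrightarrow> q_row V u (fd u) \<le> - \<eta>"
    and "\<And>u. norm u = 1 \<Longrightarrow> onorm (q_row V u) \<le> Mq"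
    and "\<And>u. norm u = 1 \<Longrightarrow> norm (fd u) \<le> Md"
    and "\<And>r u. norm u = 1 \<Longrightarrow> 0 < r \<Longrightarrow> r \<le> \<rho> \<Longrightarrow> norm (E_scaled f fd d r u) \<le> L * r powr \<delta>"
    and "\<And>r u. norm u = 1 \<Longrightarrow> 0 < r \<Longrightarrow> r \<le> \<rho> \<Longrightarrow>
           onorm (frechet_derivative (G_net m \<theta>) (at (r *\<^sub>R u))) \<le> LG"
    and "Mq * L * \<rho> powr \<delta> + \<rho> * LG * (Md + L * \<rho> powr \<delta>) < \<eta>"
    and "0 < c" and "c < 1" and "\<epsilon> > 0"
    and "\<And>x. x \<in> D \<Longrightarrow> norm x \<ge> \<rho> \<Longrightarrow> W_net V m \<theta> x \<le> c \<Longrightarrow> \<Phi>_scaled f V d m \<theta> x \<le> - \<epsilon>"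
    and "\<And>x. x \<in> frontier D \<Longrightarrow> W_net V m \<theta> x > c"
  shows "compactly_contained (\<Omega>_net D V m \<theta> c) (interior D) \<and>
         positively_invariant f (\<Omega>_net D V m \<theta> c) \<and>
         trajectories_from_converge_to_origin f (\<Omega>_net D V m \<theta> c)"
proof -
  note f = assms(1) and f0 = assms(2) and dom = assms(3) and V = assms(6) and \<rho> = assms(8)
  define H where "H = H_net V m \<theta>"
  define H' where "H' x = frechet_derivative H (at x)" for x
  define \<Omega> where "\<Omega> = \<Omega>_net D V m \<theta> c"
  have V0: "V 0 = 0" and Vpos: "\<And>x. x \<noteq> 0 \<Longrightarrow> V x > 0" and Vhom: "homogeneous p V"
    and VC: "C_k_on 1 V UNIV"
    using V unfolding local_lyapunov_def by blast+
  have Vdiff: "V differentiable (at x)" for x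
    using C1_has_derivative[OF VC] unfolding differentiable_def by blast
  have d: "d \<ge> 1" "\<delta> > 0" "L > 0"
    using dom by (simp_all add: homogeneous_dominance_def)
  have Hdiff: "H differentiable (at x)" for x
    unfolding H_def by (rule H_net_differentiable[OF Vdiff])
  then have der: "(H has_derivative H' x) (at x)" for x
    by (simp add: H'_def frechet_derivative_works)
  have cont: "continuous_on UNIV H"
    by (rule has_derivative_continuous_on[where f' = H']) (use der has_derivative_at_withinI in blast)
  have H0: "H 0 = 0" and Hpos: "\<And>x. x \<noteq> 0 \<Longrightarrow> H x > 0"
    using V0 Vpos by (simp_all add: H_def H_net_def)
  obtain a where a: "tanh a = c"
    using tanh_real_surj[of c] assms(22,23) by auto
  have "a > 0"
    using a assms(22) by (metis tanh_real_pos_iff)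
  \<comment> \<open>As tanh is strictly increasing, \<open>W \<le> c\<close> amounts to
    \<open>H \<le> a\<close>, and the argument continues with \<open>H\<close> alone.\<close>
  have \<Omega>_eq: "\<Omega> = {x\<in>D. H x \<le> a}"
    unfolding \<Omega>_def \<Omega>_net_def W_net_def H_def a[symmetric] by simp
  have "closed {x. H x \<le> a}"
    using cont by (intro closed_Collect_le continuous_intros) auto
  then have "compact \<Omega>"
    using compact_Int_closed[OF assms(9)] unfolding \<Omega>_eq by (simp add: Collect_conj_eq)
  have sub: "\<Omega> \<subseteq> interior D"
  proof
    fix x assume x: "x \<in> \<Omega>"
    then have "x \<in> D" "\<not> W_net V m \<theta> x > c"
      by (simp_all add: \<Omega>_def \<Omega>_net_def)
    then have "x \<notin> frontier D"
      using assms(26) by blast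
    with \<open>x \<in> D\<close> show "x \<in> interior D"
      using closure_subset[of D] by (auto simp: frontier_def)
  qed
  \<comment> \<open>One rate for both regimes: \<open>\<epsilon>\<close> is assumed outside the
    \<open>\<rho>\<close>-ball, the gap between \<open>\<eta>\<close> and the error bound is what
    remains inside.\<close>
  define \<kappa> where
    "\<kappa> = min \<epsilon> (\<eta> - (Mq * L * \<rho> powr \<delta> + \<rho> * LG * (Md + L * \<rho> powr \<delta>)))"
  have \<kappa>: "\<kappa> > 0"
    using assms(21,24) by (simp add: \<kappa>_def)
  have \<Phi>: "\<Phi>_scaled f V d m \<theta> x \<le> - \<kappa>" if x: "x \<in> \<Omega>" "x \<noteq> 0" for x
  proof (cases "norm x \<ge> \<rho>")
    case True
    then have "\<Phi>_scaled f V d m \<theta> x \<le> - \<epsilon>"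
      using x(1) by (intro assms(25)) (simp_all add: \<Omega>_def \<Omega>_net_def)
    then show ?thesis
      by (simp add: \<kappa>_def)
  next
    case False
    define u where "u = x /\<^sub>R norm x"
    have u: "norm u = 1" and xu: "norm x *\<^sub>R u = x"
      using x(2) by (simp_all add: u_def)
    have r: "0 < norm x" "norm x \<le> \<rho>"
      using False x(2) by simp_all
    have "\<Phi>_scaled f V d m \<theta> (norm x *\<^sub>R u) \<le>
        - \<eta> + (Mq * L * \<rho> powr \<delta> + \<rho> * LG * (Md + L * \<rho> powr \<delta>))"
      by (rule \<Phi>_scaled_near_origin[OF Vhom Vpos Vdiff r u])
        (use d assms(13-15) assms(16-18)[OF u] assms(19,20)[OF u r] in simp_all)
    then show ?thesis
      unfolding xu \<kappa>_def by simp
  qed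
  \<comment> \<open>Undoes the logarithm and the scaling in \<open>\<Phi>_scaled\<close> by
    multiplying with the positive factor \<open>H x * norm x powr (d - 1)\<close>.\<close>
  have H'_le: "H' x (f x) \<le> - (\<kappa> * H x * norm x powr (d - 1))" if x: "x \<in> \<Omega>" "x \<noteq> 0" for x
  proof -
    have "frechet_derivative (\<lambda>y. ln (H y)) (at x) = (\<lambda>v. H' x v / H x)"
      using frechet_derivative_at[OF ln_has_derivative_frechet[OF Hdiff Hpos[OF x(2)]]]
      by (simp add: H'_def)
    then have *: "norm x powr (1 - d) * (H' x (f x) / H x) \<le> - \<kappa>"
      using \<Phi>[OF x] by (simp add: \<Phi>_scaled_def H_def)
    have "H' x (f x) = (H x * norm x powr (d - 1)) * (norm x powr (1 - d) * (H' x (f x) / H x))"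
      using Hpos[OF x(2)] x(2) by (simp add: powr_diff)
    also have "\<dots> \<le> (H x * norm x powr (d - 1)) * (- \<kappa>)"
      using * Hpos[OF x(2)] by (intro mult_left_mono) auto
    finally show ?thesis
      by (simp add: mult_ac)
  qed
  have inv: "positively_invariant f \<Omega>"
    unfolding \<Omega>_eq
  proof (rule sublevel_positively_invariant[OF cont _ _ der])
    show "closed D"
      using assms(9) by (rule compact_imp_closed)
    show "{x \<in> D. H x \<le> a} \<subseteq> interior D"
      using sub unfolding \<Omega>_eq .
    \<comment> \<open>Since \<open>H 0 = 0 < a\<close>, the origin is not on this level and the
      strict estimate applies.\<close>
    fix x assume "x \<in> D" "H x = a"
    then have x: "x \<in> \<Omega>" "x \<noteq> 0"
      using \<open>a > 0\<close> H0 by (auto simp: \<Omega>_eq)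
    have "\<kappa> * H x * norm x powr (d - 1) > 0"
      using \<kappa> Hpos[OF x(2)] x(2) by simp
    then show "H' x (f x) < 0"
      using H'_le[OF x] by simp
  qed
  have "trajectories_from_converge_to_origin f \<Omega>"
  proof (rule lyapunov_trajectories_converge[OF f f0 \<open>compact \<Omega>\<close> inv H0 Hpos der])
    fix r s :: real assume rs: "r > 0" "s > 0"
    \<comment> \<open>Here \<open>d \<ge> 1\<close> matters: the exponent \<open>d - 1\<close> is
      nonnegative, so a lower bound on the norm bounds the power from below.\<close>
    have "H' x (f x) \<le> - (\<kappa> * s * r powr (d - 1))"
      if x: "x \<in> \<Omega>" "r \<le> norm x" "s \<le> H x" for x
    proof -
      have "x \<noteq> 0"
        using x(2) rs by auto
      moreover have "\<kappa> * s * r powr (d - 1) \<le> \<kappa> * H x * norm x powr (d - 1)"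
        using x rs \<kappa> d by (intro mult_mono powr_mono2) auto
      ultimately show ?thesis
        using H'_le[OF x(1)] by simp
    qed
    then show "\<exists>\<gamma>>0. \<forall>x\<in>\<Omega>. r \<le> norm x \<longrightarrow> s \<le> H x \<longrightarrow> H' x (f x) \<le> - \<gamma>"
      using rs \<kappa> by (intro exI[of _ "\<kappa> * s * r powr (d - 1)"]) simp
  qed
  moreover have "compactly_contained \<Omega> (interior D)"
    using \<open>compact \<Omega>\<close> sub by (simp add: compactly_contained_def compact_imp_closed)
  ultimately show ?thesis
    using inv by (simp add: \<Omega>_def)
qed

end
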